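(* For every value of $\rho$ (a positive integer) there exists an integer $N(\rho)\ge 2$ such that the following holds. Let $a_1<a_2<\cdots<a_d$ be positive integers with $\gcd(a_1,\ldots,a_d)=1$ and $\lceil a_1/d\rceil=\rho$, and let $F$ and $g$ be the Frobenius number and the genus of the numerical semigroup $\mathcal{S}=\{\sum_{i=1}^d\lambda_i a_i : \lambda_i\in\mathbb{N}\}$. If $a_1\ge N(\rho)$ and all prime factors of $a_1$ are greater than or equal to $\rho$, then Wilf's inequality holds: $$d\ \ge\ \frac{F+1}{F+1-g}.$$
   Context: $\mathbb{N}$ denotes the non-negative integers. Since $\gcd(a_1,\ldots,a_d)=1$, the set of gaps $\mathbb{N}\setminus\mathcal{S}$ is finite. The Frobenius number $F$ is the largest integer not belonging to $\mathcal{S}$, that is, not representable as a linear combination of $a_1,\ldots,a_d$ with coefficients in $\mathbb{N}$, and the genus is $g=|\mathbb{N}\setminus\mathcal{S}|$. When $a_1\ge 2$ one has $F+1-g=|\mathcal{S}\cap[0,F]|\ge 1$, so the fraction is well defined. *)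

theory Defs
  imports Complex_Main "HOL-Computational_Algebra.Primes"
begin

definition generated_semigroup :: "nat \<Rightarrow> (nat \<Rightarrow> nat) \<Rightarrow> nat set" where
  "generated_semigroup d a = {(\<Sum>i = 1..d. c i * a i) | c :: nat \<Rightarrow> nat. True}"

text \<open>
  The maximum ranges over all integers, so the Frobenius number of the full
  semigroup of non-negative integers is -1. It is only meaningful for a set with
  finite complement in the non-negative integers.
\<close>

definition frobenius_number :: "nat set \<Rightarrow> int" where
  "frobenius_number S = (GREATEST z. z \<notin> int ` S)"

text \<open>
  The cardinality is 0 by convention if there are infinitely many gaps; this does not
  occur for semigroups with coprime generators.
\<close>

definition genus :: "nat set \<Rightarrow> nat" where
  "genus S = card (UNIV - S)"

end

theory Submission
  imports Defs
begin

text \<open>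
  Put \<open>m = a 1\<close> and let \<open>N x\<close> be the number of residues modulo \<open>m\<close> of the elements of the
  semigroup that are at most \<open>x\<close>. This is also the number of elements in \<open>{x - m<..x}\<close>, so Wilf's
  inequality follows if the sum of \<open>d * N (F - i * m) - m\<close> over \<open>i \<le> F div m\<close> is non-negative.
  Terms with \<open>N \<ge> \<rho>\<close> are non-negative, and terms with \<open>N \<ge> M\<close> are large when \<open>M\<close> is.
  If \<open>\<mu>\<close> is the least element not divisible by \<open>m\<close>, then \<open>0, \<mu>, \<dots>, (\<rho> - 1) * \<mu>\<close> are
  distinct modulo \<open>m\<close> because \<open>m\<close> has no prime factor below \<open>\<rho>\<close>, so the number of terms with
  \<open>N < \<rho>\<close> is bounded in terms of \<open>\<mu>\<close>. If these terms outweigh the \<open>t\<close> terms with \<open>N \<ge> M\<close>,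
  then \<open>t\<close> is so small that \<open>(t + 1) * m \<le> \<mu>\<close>. As every element of the Apery set is at most \<open>F + m\<close>,
  each residue then comes from a generator or is a sum of two of the at most \<open>M - 2\<close>
  nonzero residues counted by \<open>N (F - t * m)\<close>, whence \<open>m \<le> d + (M - 2)\<^sup>2\<close>. For \<open>\<rho> \<ge> 3\<close> this bounds \<open>m\<close>; for
  \<open>\<rho> = 2\<close> it makes \<open>d\<close> so close to \<open>m\<close> that the argument can be repeated with \<open>M = 2\<close>.
\<close>

section \<open>Submonoids of the natural numbers\<close>

locale nat_submonoid =
  fixes S :: "nat set"
  assumes zero_mem: "0 \<in> S"
    and add_mem: "x \<in> S \<Longrightarrow> y \<in> S \<Longrightarrow> x + y \<in> S"
begin

lemma mult_mem: "x \<in> S \<Longrightarrow> k * x \<in> S"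
  by (induction k) (auto simp: zero_mem add_mem)

text \<open>The least positive difference \<open>e\<close> of two elements divides every element, so
  it is 1. The consecutive elements \<open>t\<close> and \<open>t + 1\<close> then generate
  everything from \<open>t * t\<close> on.\<close>

lemma finite_gaps:
  assumes "Gcd S = 1"
  shows "finite (- S)"
proof -
  define D where "D = {n. n > 0 \<and> (\<exists>s\<in>S. s + n \<in> S)}"
  have "\<exists>x\<in>S. x > 0"
    using assms by (metis Gcd_0_iff gr0I singletonI subsetI zero_neq_one)
  then have "\<exists>n. n \<in> D"
    unfolding D_def using zero_mem by (metis (mono_tags, lifting) add_0 mem_Collect_eq)
  define e where "e = (LEAST n. n \<in> D)"
  have "e \<in> D"
    unfolding e_def by (rule LeastI_ex) fact
  then obtain t where t: "t \<in> S" "t + e \<in> S" and e: "e > 0"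
    by (auto simp: D_def)
  have "e dvd s" if s: "s \<in> S" for s
  proof (rule ccontr)
    assume "\<not> e dvd s"
    then have pos: "s mod e > 0"
      by (simp add: dvd_eq_mod_eq_0)
    \<comment> \<open>This exhibits \<open>s mod e\<close> as a difference of two elements, against
      the minimality of \<open>e\<close>.\<close>
    have "(s div e) * (t + e) + s mod e = (s div e) * t + s"
      by (simp add: algebra_simps)
    then have "s mod e \<in> D"
      unfolding D_def using pos mult_mem[OF t(1)] mult_mem[OF t(2)] add_mem s
      by (metis (mono_tags, lifting) mem_Collect_eq)
    then have "e \<le> s mod e"
      unfolding e_def by (rule Least_le)
    then show False
      using e by (meson mod_less_divisor not_le)
  qed
  then have "e dvd Gcd S"
    by (rule Gcd_greatest)
  then have "t + 1 \<in> S"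
    using assms t by simp
  have "n \<in> S" if n: "n \<ge> t * t" for n
  proof (cases "t = 0")
    case True
    then show ?thesis
      using mult_mem[OF \<open>t + 1 \<in> S\<close>, of n] by simp
  next
    case False
    then have "n mod t < t" and "t \<le> n div t"
      using n by (simp_all add: less_eq_div_iff_mult_less_eq)
    \<comment> \<open>With quotient \<open>q\<close> and remainder \<open>r\<close>,
      \<open>n = (q - r) * t + r * (t + 1)\<close>; here \<open>r < t \<le> q\<close>, so the
      subtraction does not truncate.\<close>
    then have "(n div t - n mod t) * t + n mod t * t = n div t * t"
      by (simp flip: add_mult_distrib)
    then have "(n div t - n mod t) * t + n mod t * (t + 1) = n"
      using div_mult_mod_eq[of n t] unfolding distrib_left by linarith
    then show ?thesis
      using mult_mem[OF t(1)] mult_mem[OF \<open>t + 1 \<in> S\<close>] add_mem by metis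
  qed
  then have "- S \<subseteq> {..<t * t}"
    by (auto simp: not_le[symmetric])
  then show ?thesis
    by (rule finite_subset) simp
qed

end

section \<open>Counting residues modulo the multiplicity\<close>

locale numerical_semigroup = nat_submonoid +
  fixes m F :: nat
  assumes m_mem: "m \<in> S"
    and m_ge2: "m \<ge> 2"
    and m_le: "s \<in> S \<Longrightarrow> s > 0 \<Longrightarrow> m \<le> s"
    and F_notin: "F \<notin> S"
    and gt_F: "n > F \<Longrightarrow> n \<in> S"
begin

definition residues :: "nat \<Rightarrow> nat set" where
  "residues x = (\<lambda>s. s mod m) ` (S \<inter> {..x})"

lemma finite_residues [simp]: "finite (residues x)"
  by (simp add: residues_def)

lemma residues_mono: "x \<le> y \<Longrightarrow> residues x \<subseteq> residues y"
  by (auto simp: residues_def)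

lemma zero_in_residues: "0 \<in> residues x"
  unfolding residues_def using zero_mem by force

lemma card_residues_pos: "card (residues x) \<ge> 1"
  using zero_in_residues[of x] finite_residues[of x] card_gt_0_iff[of "residues x"] by force

lemma card_residues_less_m:
  assumes "x < m"
  shows "card (residues x) = 1"
proof -
  have "S \<inter> {..x} = {0}"
    using assms m_le zero_mem by force
  then show ?thesis
    by (simp add: residues_def)
qed

text \<open>Adding multiples of \<open>m\<close> moves any element up to \<open>x + m\<close> into
  the last window of length \<open>m\<close>, keeping its residue and staying in
  \<open>S\<close>.\<close>

lemma card_residues_le: "card (residues (x + m)) \<le> card (S \<inter> {x<..x + m})"
proof -
  have "residues (x + m) \<subseteq> (\<lambda>s. s mod m) ` (S \<inter> {x<..x + m})"
  proof
    fix r assume "r \<in> residues (x + m)"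
    then obtain s where s: "s \<in> S" "s \<le> x + m" "r = s mod m"
      by (auto simp: residues_def)
    define k where "k = (x + m - s) div m"
    have "k * m + (x + m - s) mod m = x + m - s" "(x + m - s) mod m < m"
      using m_ge2 by (simp_all add: k_def)
    then have "s + k * m \<in> {x<..x + m}"
      unfolding greaterThanAtMost_iff using s by linarith
    moreover have "s + k * m \<in> S"
      using s m_mem by (simp add: add_mem mult_mem)
    ultimately show "r \<in> (\<lambda>s. s mod m) ` (S \<inter> {x<..x + m})"
      using s by (intro image_eqI[of _ _ "s + k * m"]) auto
  qed
  then show ?thesis
    by (meson card_image_le card_mono finite_Int finite_greaterThanAtMost finite_imageI le_trans)
qed

text \<open>The windows of length \<open>m\<close> above \<open>r\<close> are disjoint, and each
  holds at least as many elements as there are residues at its right end.\<close>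

lemma sum_card_residues_le:
  assumes "r < m"
  shows "(\<Sum>i\<le>n. card (residues (r + i * m))) \<le> card (S \<inter> {..r + n * m})"
proof (induction n)
  case 0
  show ?case
    using card_image_le[of "S \<inter> {..r}"] by (simp add: residues_def)
next
  case (Suc n)
  let ?x = "r + n * m"
  have "S \<inter> {..?x + m} = (S \<inter> {..?x}) \<union> (S \<inter> {?x<..?x + m})"
    by auto
  then have "card (S \<inter> {..?x + m}) = card (S \<inter> {..?x}) + card (S \<inter> {?x<..?x + m})"
    by (simp add: card_Un_disjoint disjoint_iff)
  then show ?case
    using Suc card_residues_le[of ?x] by (simp add: algebra_simps)
qed

definition \<mu> :: nat where
  "\<mu> = (LEAST s. s \<in> S \<and> \<not> m dvd s)"

lemma \<mu>_mem: "\<mu> \<in> S" and \<mu>_not_dvd: "\<not> m dvd \<mu>"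
proof -
  \<comment> \<open>Two consecutive elements are not both divisible by \<open>m\<close>, so
    \<open>\<mu>\<close> exists.\<close>
  have "F + 1 \<in> S" "F + 2 \<in> S"
    using gt_F by simp_all
  moreover have "\<not> (m dvd F + 1 \<and> m dvd F + 2)"
  proof
    assume *: "m dvd F + 1 \<and> m dvd F + 2"
    then have "m dvd (F + 2) - (F + 1)"
      by (intro dvd_diff_nat) auto
    then show False
      using m_ge2 by simp
  qed
  ultimately have "\<exists>s. s \<in> S \<and> \<not> m dvd s"
    by blast
  then have "\<mu> \<in> S \<and> \<not> m dvd \<mu>"
    unfolding \<mu>_def by (rule LeastI_ex)
  then show "\<mu> \<in> S" "\<not> m dvd \<mu>"
    by simp_all
qed

lemma \<mu>_le: "s \<in> S \<Longrightarrow> \<not> m dvd s \<Longrightarrow> \<mu> \<le> s"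
  unfolding \<mu>_def by (rule Least_le) simp

lemma m_le_\<mu>: "m \<le> \<mu>"
  using \<mu>_mem \<mu>_not_dvd m_le by (metis dvd_0_right gr0I)

lemma card_residues_multiples_\<mu>:
  assumes "\<rho> \<ge> 1" and primes: "\<And>p. prime p \<Longrightarrow> p dvd m \<Longrightarrow> p \<ge> \<rho>"
  shows "card (residues ((\<rho> - 1) * \<mu>)) \<ge> \<rho>"
proof -
  have ne: "i * \<mu> mod m \<noteq> j * \<mu> mod m" if "i < j" "j < \<rho>" for i j
  proof
    assume "i * \<mu> mod m = j * \<mu> mod m"
    then have "m dvd j * \<mu> - i * \<mu>"
      using mod_eq_dvd_iff_nat[of "i * \<mu>" "j * \<mu>" m] that by simp
    then have "m dvd (j - i) * \<mu>"
      by (simp add: diff_mult_distrib)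
    \<comment> \<open>A common prime factor would be at most \<open>j - i < \<rho>\<close>.\<close>
    moreover have "coprime m (j - i)"
    proof (rule ccontr)
      assume "\<not> coprime m (j - i)"
      then obtain p where p: "prime p" "p dvd m" "p dvd j - i"
        using not_coprimeE prime_factor_nat by (metis coprime_iff_gcd_eq_1 gcd_nat.boundedE)
      then have "p \<le> j - i"
        using that by (intro dvd_imp_le) auto
      then show False
        using primes[OF p(1,2)] that by linarith
    qed
    ultimately have "m dvd \<mu>"
      by (simp add: coprime_dvd_mult_right_iff)
    then show False
      using \<mu>_not_dvd by simp
  qed
  have "inj_on (\<lambda>j. j * \<mu> mod m) {..<\<rho>}"
    by (rule linorder_inj_onI) (use ne in auto)
  then have "\<rho> = card ((\<lambda>j. j * \<mu> mod m) ` {..<\<rho>})"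
    by (simp add: card_image)
  also have "\<dots> \<le> card (residues ((\<rho> - 1) * \<mu>))"
    unfolding residues_def using mult_mem[OF \<mu>_mem]
    by (intro card_mono) (auto intro!: imageI)
  finally show ?thesis .
qed

text \<open>The windows are indexed upwards from \<open>F mod m\<close>, so the last one ends at
  \<open>F\<close>. The hypothesis bounds \<open>(F div m + 1) * m\<close>, which is at least
  \<open>F + 1\<close>.\<close>

lemma wilf_of_sum_nonneg:
  assumes "(\<Sum>i\<le>F div m. int d * int (card (residues (F mod m + i * m))) - int m) \<ge> 0"
  shows "F + 1 \<le> d * card (S \<inter> {..F})"
proof -
  let ?c = "\<lambda>i. card (residues (F mod m + i * m))"
  have "int (F div m + 1) * int m \<le> int d * (\<Sum>i\<le>F div m. int (?c i))"
    using assms by (simp add: sum_subtractf sum_distrib_left)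
  then have "(F div m + 1) * m \<le> d * (\<Sum>i\<le>F div m. ?c i)"
    by (simp only: of_nat_sum[symmetric] of_nat_mult[symmetric] of_nat_le_iff)
  also have "\<dots> \<le> d * card (S \<inter> {..F})"
    using sum_card_residues_le[of "F mod m" "F div m"] m_ge2 by (simp add: mult.commute)
  finally show ?thesis
    using mod_less_divisor[of m F] div_mult_mod_eq[of F m] m_ge2
    unfolding add_mult_distrib by linarith
qed

text \<open>No summand is negative, because the residue 0 is always counted.\<close>

lemma wilf_of_m_le:
  assumes "m \<le> d"
  shows "F + 1 \<le> d * card (S \<inter> {..F})"
proof (rule wilf_of_sum_nonneg, rule sum_nonneg)
  fix i
  have "m * 1 \<le> d * card (residues (F mod m + i * m))"
    using assms card_residues_pos by (intro mult_mono) auto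
  then show "0 \<le> int d * int (card (residues (F mod m + i * m))) - int m"
    by (metis mult.right_neutral diff_ge_0_iff_ge of_nat_le_iff of_nat_mult)
qed

end

section \<open>Wilf's inequality for large multiplicity\<close>

locale generated_numerical_semigroup = numerical_semigroup +
  fixes G :: "nat set"
  assumes finite_G: "finite G"
    and m_in_G: "m \<in> G"
    and G_subset: "G \<subseteq> S"
    and split_generator: "s \<in> S \<Longrightarrow> s > 0 \<Longrightarrow> \<exists>g\<in>G. \<exists>s'\<in>S. g > 0 \<and> s = g + s'"
begin

lemma m_le_card_generators:
  assumes "(t + 1) * m \<le> \<mu>" and "t * m \<le> F"
  shows "m \<le> card G + (card (residues (F - t * m)) - 1)\<^sup>2"
proof -
  define A where "A = residues (F - t * m) - {0}"
  have "{..<m} \<subseteq> (\<lambda>g. g mod m) ` G \<union> (\<lambda>(u, v). (u + v) mod m) ` (A \<times> A)"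
  proof
    fix r assume "r \<in> {..<m}"
    then have r: "r < m"
      by simp
    show "r \<in> (\<lambda>g. g mod m) ` G \<union> (\<lambda>(u, v). (u + v) mod m) ` (A \<times> A)"
    proof (cases "r = 0")
      case True
      then show ?thesis
        using m_in_G by force
    next
      case False
      \<comment> \<open>\<open>w\<close> is the Apery element of the class \<open>r\<close>.\<close>
      define w where "w = (LEAST s. s \<in> S \<and> s mod m = r)"
      have "F < r + (F + 1) * m"
        using m_ge2 mult_le_mono2[of 1 m "F + 1"] by (simp only: mult_1_right) linarith
      then have "r + (F + 1) * m \<in> S \<and> (r + (F + 1) * m) mod m = r"
        using gt_F r by (metis mod_less mod_mult_self1)
      then have w: "w \<in> S" "w mod m = r"
        unfolding w_def by (metis (mono_tags, lifting) LeastI)+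
      have least: "w \<le> s" if "s \<in> S" "s mod m = r" for s
        unfolding w_def using that by (intro Least_le) simp
      have w_le: "w \<le> F + m"
      proof (rule ccontr)
        assume "\<not> w \<le> F + m"
        then have "w - m \<in> S" "(w - m) mod m = r"
          using w gt_F by (simp_all add: le_mod_geq)
        then show False
          using least \<open>\<not> w \<le> F + m\<close> m_ge2 by fastforce
      qed
      have "w > 0"
        using w False by (metis gr0I mod_0)
      then obtain g s where gs: "g \<in> G" "s \<in> S" "g > 0" "w = g + s"
        using split_generator w by blast
      \<comment> \<open>Otherwise \<open>s\<close> would be a smaller element of the class of
        \<open>w\<close>.\<close>
      have "\<not> m dvd g"
      proof
        assume "m dvd g"
        then have "s mod m = r"
          using w gs by (metis mod_add_left_eq dvd_imp_mod_0 add_0)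
        then show False
          using least gs by fastforce
      qed
      show ?thesis
      proof (cases "m dvd s")
        case True
        then have "g mod m = r"
          using w gs by (metis mod_add_right_eq dvd_imp_mod_0 add.right_neutral)
        then show ?thesis
          using gs by blast
      next
        case False
        have "g \<in> S"
          using gs G_subset by blast
        have "\<mu> \<le> g" "\<mu> \<le> s"
          using \<mu>_le \<open>\<not> m dvd g\<close> False \<open>g \<in> S\<close> gs by auto
        \<comment> \<open>Each summand is at least \<open>(t + 1) * m\<close> and their sum is at
          most \<open>F + m\<close>.\<close>
        then have "g \<le> F - t * m" "s \<le> F - t * m"
          using assms w_le gs by auto
        then have "g mod m \<in> A" "s mod m \<in> A"
          using gs \<open>g \<in> S\<close> \<open>\<not> m dvd g\<close> False
          by (auto simp: A_def residues_def dvd_eq_mod_eq_0)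
        moreover have "r = (g mod m + s mod m) mod m"
          using w gs by (simp add: mod_simps)
        ultimately show ?thesis
          by force
      qed
    qed
  qed
  then have "card {..<m} \<le> card ((\<lambda>g. g mod m) ` G \<union> (\<lambda>(u, v). (u + v) mod m) ` (A \<times> A))"
    by (intro card_mono) (auto simp: A_def finite_G)
  also have "\<dots> \<le> card ((\<lambda>g. g mod m) ` G) + card ((\<lambda>(u, v). (u + v) mod m) ` (A \<times> A))"
    by (rule card_Un_le)
  also have "\<dots> \<le> card G + card (A \<times> A)"
    by (intro add_mono card_image_le) (auto simp: A_def finite_G)
  also have "card (A \<times> A) = (card (residues (F - t * m)) - 1)\<^sup>2"
    by (simp add: A_def card_cartesian_product power2_eq_square zero_in_residues)
  finally show ?thesis
    by simp
qed

text \<open>The bound on \<open>M\<close> rearranges to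
  \<open>4 * \<rho> * (m - d) \<le> M * d - m\<close>: a term with at least \<open>M\<close>
  residues gains at least \<open>4 * \<rho>\<close> times what one with fewer than
  \<open>\<rho>\<close> can lose. \<open>M\<close> stays free because two values of it are used
  later.\<close>

lemma wilf_or_m_le:
  assumes \<rho>: "2 \<le> \<rho>" "\<rho> \<le> M" and primes: "\<And>p. prime p \<Longrightarrow> p dvd m \<Longrightarrow> p \<ge> \<rho>"
    and d: "card G = d" "m \<le> \<rho> * d" and M: "(4 * \<rho> + 1) * m \<le> (M + 4 * \<rho>) * d"
  shows "F + 1 \<le> d * card (S \<inter> {..F}) \<or> m \<le> d + (M - 2)\<^sup>2"
proof (rule disjCI)
  assume notle: "\<not> m \<le> d + (M - 2)\<^sup>2"
  show "F + 1 \<le> d * card (S \<inter> {..F})"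
  proof (rule ccontr)
    assume notwilf: "\<not> F + 1 \<le> d * card (S \<inter> {..F})"
    define L where "L = F div m"
    define c where "c i = card (residues (F mod m + i * m))" for i
    have c_pos: "c i \<ge> 1" for i
      unfolding c_def by (rule card_residues_pos)
    have c_mono: "c i \<le> c j" if "i \<le> j" for i j
      unfolding c_def using that by (intro card_mono residues_mono) auto
    have c_0: "c 0 = 1"
      unfolding c_def using m_ge2 by (simp add: card_residues_less_m)
    define few where "few = {i. i \<le> L \<and> c i < \<rho>}"
    define many where "many = {i. i \<le> L \<and> c i \<ge> M}"
    define K where "K = card few"
    define t where "t = card many"
    have sets: "few \<subseteq> {..L}" "many \<subseteq> {..L}"
      by (auto simp: few_def many_def)
    have fin: "finite few" "finite many"
      using sets finite_subset by blast+
    define \<alpha> where "\<alpha> = int M * int d - int m"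
    define \<beta> where "\<beta> = int m - int d"
    have "\<beta> > 0"
      using notle by (simp add: \<beta>_def)
    have "int (4 * \<rho> + 1) * int m \<le> int (M + 4 * \<rho>) * int d"
      using M by (simp only: of_nat_mult[symmetric] of_nat_le_iff)
    then have \<alpha>\<beta>: "4 * int \<rho> * \<beta> \<le> \<alpha>"
      by (simp add: \<alpha>_def \<beta>_def algebra_simps)
    have pointwise: "(if i \<in> many then \<alpha> else 0) - (if i \<in> few then \<beta> else 0) \<le> int d * int (c i) - int m"
      if "i \<le> L" for i
    proof -
      consider "c i < \<rho>" | "\<rho> \<le> c i" "c i < M" | "M \<le> c i"
        by linarith
      then show ?thesis
      proof cases
        case 1
        have "int d * 1 \<le> int d * int (c i)"
          using c_pos[of i] by (intro mult_left_mono) auto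
        then show ?thesis
          using 1 that \<rho> by (simp add: few_def many_def \<beta>_def)
      next
        case 2
        have "\<rho> * d \<le> c i * d"
          using 2 by (intro mult_right_mono) auto
        then have "m \<le> d * c i"
          using d by (simp only: mult.commute[of d])
        then have "int m \<le> int d * int (c i)"
          by (simp only: of_nat_mult[symmetric] of_nat_le_iff)
        then show ?thesis
          using 2 that by (simp add: few_def many_def)
      next
        case 3
        have "int M * int d \<le> int (c i) * int d"
          using 3 by (intro mult_right_mono) auto
        then show ?thesis
          using 3 that \<rho> by (simp add: few_def many_def \<alpha>_def mult.commute)
      qed
    qed
    have "int t * \<alpha> - int K * \<beta> = (\<Sum>i\<le>L. (if i \<in> many then \<alpha> else 0) - (if i \<in> few then \<beta> else 0))"
      using sets by (simp add: sum_subtractf sum.If_cases t_def K_def Int_absorb1)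
    also have "\<dots> \<le> (\<Sum>i\<le>L. int d * int (c i) - int m)"
      by (intro sum_mono pointwise) simp
    also have "\<dots> < 0"
      using notwilf wilf_of_sum_nonneg[of d] unfolding c_def L_def by linarith
    finally have "int t * \<alpha> < int K * \<beta>"
      by simp
    moreover have "int t * (4 * int \<rho> * \<beta>) \<le> int t * \<alpha>"
      using \<alpha>\<beta> by (intro mult_left_mono) auto
    ultimately have "(int t * 4 * int \<rho>) * \<beta> < int K * \<beta>"
      by (simp add: mult.assoc)
    then have "int t * 4 * int \<rho> < int K"
      using \<open>\<beta> > 0\<close> by simp
    then have "int (t * 4 * \<rho>) < int K"
      by simp
    then have tK: "t * 4 * \<rho> < K"
      by (simp only: of_nat_less_iff)
    \<comment> \<open>By monotonicity \<open>few\<close> is an initial segment of indices, nonempty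
      since \<open>K > 0\<close>.\<close>
    have "c (K - 1) < \<rho>"
    proof (rule ccontr)
      assume "\<not> c (K - 1) < \<rho>"
      then have "few \<subseteq> {..<K - 1}"
        using c_mono by (force simp: few_def not_less[symmetric])
      then have "K \<le> K - 1"
        unfolding K_def by (metis card_lessThan card_mono finite_lessThan)
      then show False
        using tK by linarith
    qed
    moreover have "\<rho> \<le> card (residues ((\<rho> - 1) * \<mu>))"
      using \<rho> primes by (intro card_residues_multiples_\<mu>) auto
    ultimately have "\<not> (\<rho> - 1) * \<mu> \<le> F mod m + (K - 1) * m"
      unfolding c_def using card_mono[OF finite_residues residues_mono] le_trans not_le by blast
    then have K_lt: "(K - 1) * m < (\<rho> - 1) * \<mu>"
      by linarith
    \<comment> \<open>For \<open>t > 0\<close>, \<open>t + 1 \<le> 2 * t\<close> and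
      \<open>4 * \<rho> * t < K\<close> give \<open>(\<rho> - 1) * (t + 1) \<le> K - 1\<close>; then
      \<open>\<rho> - 1\<close> cancels against \<open>K_lt\<close>.\<close>
    have t_\<mu>: "(t + 1) * m \<le> \<mu>"
    proof (cases "t = 0")
      case True
      then show ?thesis
        using m_le_\<mu> by simp
    next
      case False
      then have "(\<rho> - 1) * (t + 1) \<le> \<rho> * (2 * t)"
        by (intro mult_mono) auto
      also have "\<dots> \<le> 2 * (\<rho> * (2 * t))"
        by simp
      also have "\<dots> \<le> K - 1"
        using tK by (simp add: ac_simps)
      finally have "(\<rho> - 1) * (t + 1) * m \<le> (K - 1) * m"
        by (rule mult_right_mono) simp
      then have "(\<rho> - 1) * ((t + 1) * m) < (\<rho> - 1) * \<mu>"
        using K_lt by (simp only: mult.assoc)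
      then show ?thesis
        by simp
    qed
    \<comment> \<open>This yields \<open>t \<le> L\<close>, so that \<open>L - t\<close> and
      \<open>F - t * m\<close> do not truncate.\<close>
    have "0 \<notin> many"
      using c_0 \<rho> by (simp add: many_def)
    then have "many \<subseteq> {1..L}"
      using sets by (force simp: Suc_le_eq intro: gr0I)
    then have "t \<le> L"
      unfolding t_def using card_mono[of "{1..L}" many] by simp
    \<comment> \<open>\<open>many\<close> is a final segment with \<open>t\<close> indices, so
      \<open>L - t\<close> lies just below it.\<close>
    have "c (L - t) < M"
    proof (rule ccontr)
      assume "\<not> c (L - t) < M"
      then have "{L - t..L} \<subseteq> many"
        using c_mono by (force simp: many_def)
      then have "card {L - t..L} \<le> t"
        unfolding t_def using fin by (intro card_mono)
      then show False
        using \<open>t \<le> L\<close> by simp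
    qed
    have "F mod m + L * m = F"
      by (simp add: L_def)
    moreover have "t * m \<le> L * m"
      using \<open>t \<le> L\<close> by simp
    ultimately have tF: "t * m \<le> F" and "F mod m + (L - t) * m = F - t * m"
      unfolding diff_mult_distrib by linarith+
    then have "card (residues (F - t * m)) < M"
      using \<open>c (L - t) < M\<close> by (simp add: c_def)
    then have "(card (residues (F - t * m)) - 1)\<^sup>2 \<le> (M - 2)\<^sup>2"
      by (intro power_mono) auto
    then show False
      using m_le_card_generators[OF t_\<mu> tF] d notle by linarith
  qed
qed

text \<open>For \<open>M = 4 * \<rho>\<^sup>2 + \<rho>\<close>, the bound
  \<open>m \<le> \<rho> * d\<close> already implies the condition on \<open>M\<close>. If Wilf's
  inequality failed, \<open>m - d\<close> would be at most \<open>M\<^sup>2\<close>, hence below a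
  tenth of \<open>m\<close>.\<close>

lemma wilf:
  assumes "\<rho> \<ge> 1" and primes: "\<And>p. prime p \<Longrightarrow> p dvd m \<Longrightarrow> p \<ge> \<rho>"
    and d: "card G = d" "m \<le> \<rho> * d" "(\<rho> - 1) * d < m"
    and m_large: "m \<ge> 10 * (4 * \<rho>\<^sup>2 + \<rho>)\<^sup>2 + 2"
  shows "F + 1 \<le> d * card (S \<inter> {..F})"
proof (rule ccontr)
  assume notwilf: "\<not> ?thesis"
  then have "d < m"
    using wilf_of_m_le not_le by blast
  then have "\<rho> \<ge> 2"
    using d \<open>\<rho> \<ge> 1\<close> by (cases "\<rho> = 1") auto
  define M where "M = 4 * \<rho>\<^sup>2 + \<rho>"
  have "(4 * \<rho> + 1) * m \<le> (4 * \<rho> + 1) * (\<rho> * d)"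
    using d by (intro mult_left_mono) auto
  also have "\<dots> = M * d"
    by (simp add: M_def power2_eq_square algebra_simps)
  also have "\<dots> \<le> (M + 4 * \<rho>) * d"
    by simp
  finally have m_le: "m \<le> d + (M - 2)\<^sup>2"
    using wilf_or_m_le[of \<rho> M d] \<open>\<rho> \<ge> 2\<close> primes d notwilf by (simp add: M_def)
  have "(M - 2)\<^sup>2 \<le> M\<^sup>2"
    by (intro power_mono) auto
  then have close: "10 * (m - d) < m"
    using m_le m_large unfolding M_def by linarith
  show False
  proof (cases "\<rho> = 2")
    case True
    \<comment> \<open>This is \<open>10 * (m - d) \<le> m\<close>, the origin of the constant 10.
      For \<open>M = 2\<close> the second alternative becomes \<open>m \<le> d\<close>.\<close>
    have "(4 * 2 + 1) * m \<le> (2 + 4 * 2) * d"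
      using close \<open>d < m\<close> by simp
    then show False
      using wilf_or_m_le[of 2 2 d] True primes d notwilf \<open>d < m\<close> by simp
  next
    case False
    \<comment> \<open>Now \<open>2 * d < m\<close>, so \<open>m - d\<close> exceeds half of
      \<open>m\<close>.\<close>
    then have "2 * d \<le> (\<rho> - 1) * d"
      using \<open>\<rho> \<ge> 2\<close> by (intro mult_right_mono) auto
    then show False
      using d close by linarith
  qed
qed

end

section \<open>The semigroup generated by a sequence\<close>

lemma nat_submonoid_generated_semigroup: "nat_submonoid (generated_semigroup d a)"
proof
  show "0 \<in> generated_semigroup d a"
    unfolding generated_semigroup_def by (auto intro!: exI[of _ "\<lambda>_. 0"])
next
  fix x y assume "x \<in> generated_semigroup d a" "y \<in> generated_semigroup d a"
  then obtain c c' where "x = (\<Sum>i = 1..d. c i * a i)" "y = (\<Sum>i = 1..d. c' i * a i)"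
    by (auto simp: generated_semigroup_def)
  then have "x + y = (\<Sum>i = 1..d. (c i + c' i) * a i)"
    by (simp add: sum.distrib add_mult_distrib)
  then show "x + y \<in> generated_semigroup d a"
    unfolding generated_semigroup_def by (auto intro!: exI[of _ "\<lambda>i. c i + c' i"])
qed

lemma generator_mem:
  assumes "i \<in> {1..d}"
  shows "a i \<in> generated_semigroup d a"
proof -
  have "a i = (\<Sum>j = 1..d. (if j = i then 1 else 0) * a j)"
    using assms by (simp add: if_distrib[of "\<lambda>x. x * _"] sum.delta cong: if_cong)
  then show ?thesis
    unfolding generated_semigroup_def by (intro CollectI exI[of _ "\<lambda>j. if j = i then 1 else 0"]) simp
qed

lemma generated_semigroup_split:
  assumes "s \<in> generated_semigroup d a" "s > 0"
  shows "\<exists>i\<in>{1..d}. \<exists>s'\<in>generated_semigroup d a. a i > 0 \<and> s = a i + s'"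
proof -
  obtain c where c: "s = (\<Sum>i = 1..d. c i * a i)"
    using assms by (auto simp: generated_semigroup_def)
  then have "\<not> (\<forall>i\<in>{1..d}. c i * a i = 0)"
    using assms(2) sum.neutral[of "{1..d}" "\<lambda>i. c i * a i"] by linarith
  then obtain i where i: "i \<in> {1..d}" "c i * a i > 0"
    by blast
  \<comment> \<open>One copy of \<open>a i\<close> is removed; \<open>c i > 0\<close> keeps the
    subtraction exact.\<close>
  define c' where "c' = c(i := c i - 1)"
  have "s = c i * a i + (\<Sum>j\<in>{1..d} - {i}. c j * a j)"
    unfolding c using i by (simp add: sum.remove)
  also have "(\<Sum>j\<in>{1..d} - {i}. c j * a j) = (\<Sum>j\<in>{1..d} - {i}. c' j * a j)"
    by (rule sum.cong) (auto simp: c'_def)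
  also have "c i * a i = a i + c' i * a i"
    using i by (cases "c i") (auto simp: c'_def)
  finally have "s = a i + (\<Sum>j = 1..d. c' j * a j)"
    using i by (simp add: sum.remove)
  moreover have "(\<Sum>j = 1..d. c' j * a j) \<in> generated_semigroup d a" "a i > 0"
    using i by (auto simp: generated_semigroup_def)
  ultimately show ?thesis
    using i by blast
qed

theorem theorem1:
  fixes \<rho> :: nat
  assumes "\<rho> \<ge> 1"
  shows "\<exists>N::nat. N \<ge> 2 \<and>
    (\<forall>(d::nat) (a :: nat \<Rightarrow> nat) (F::int) (g::nat).
      d \<ge> 1 \<longrightarrow>
      (\<forall>i\<in>{1..d}. a i > 0) \<longrightarrow>
      strict_mono_on {1..d} a \<longrightarrow>
      Gcd (a ` {1..d}) = 1 \<longrightarrow>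
      \<lceil>real (a 1) / real d\<rceil> = int \<rho> \<longrightarrow>
      F = frobenius_number (generated_semigroup d a) \<longrightarrow>
      g = genus (generated_semigroup d a) \<longrightarrow>
      a 1 \<ge> N \<longrightarrow>
      (\<forall>p. prime p \<longrightarrow> p dvd a 1 \<longrightarrow> p \<ge> \<rho>) \<longrightarrow>
      real d \<ge> (real_of_int F + 1) / (real_of_int F + 1 - real g))"
proof (intro exI[of _ "10 * (4 * \<rho>\<^sup>2 + \<rho>)\<^sup>2 + 2"] conjI allI impI)
  show "2 \<le> 10 * (4 * \<rho>\<^sup>2 + \<rho>)\<^sup>2 + 2"
    by simp
next
  fix d :: nat and a :: "nat \<Rightarrow> nat" and F :: int and g :: nat
  assume "d \<ge> 1" and pos: "\<forall>i\<in>{1..d}. a i > 0" and mono: "strict_mono_on {1..d} a"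
    and gcd: "Gcd (a ` {1..d}) = 1" and ceil: "\<lceil>real (a 1) / real d\<rceil> = int \<rho>"
    and F: "F = frobenius_number (generated_semigroup d a)"
    and g: "g = genus (generated_semigroup d a)"
    and large: "a 1 \<ge> 10 * (4 * \<rho>\<^sup>2 + \<rho>)\<^sup>2 + 2"
    and primes: "\<forall>p. prime p \<longrightarrow> p dvd a 1 \<longrightarrow> p \<ge> \<rho>"
  define S where "S = generated_semigroup d a"
  interpret nat_submonoid S
    unfolding S_def by (rule nat_submonoid_generated_semigroup)
  have gen: "a ` {1..d} \<subseteq> S"
    unfolding S_def using generator_mem by blast
  have least: "a 1 \<le> s" if s: "s \<in> S" "s > 0" for s
  proof -
    obtain i s' where "i \<in> {1..d}" "s = a i + s'"
      using generated_semigroup_split[of s d a] s unfolding S_def by blast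
    then show ?thesis
      using strict_mono_on_leD[OF mono, of 1 i] \<open>d \<ge> 1\<close> by simp
  qed
  have "Gcd S dvd Gcd (a ` {1..d})"
    using gen by (intro Gcd_greatest Gcd_dvd) auto
  then have fin: "finite (- S)"
    using gcd by (intro finite_gaps) simp
  \<comment> \<open>A gap exists, so the maximum \<open>f\<close> is attained and the Frobenius
    number is not -1.\<close>
  have "1 \<notin> S"
    using least[of 1] large by auto
  define f where "f = Max (- S)"
  have f: "f \<notin> S" "n > f \<Longrightarrow> n \<in> S" for n
    using Max_in[OF fin] Max_ge[OF fin, of n] \<open>1 \<notin> S\<close> by (auto simp: f_def)
  have F_eq: "F = int f"
    unfolding F frobenius_number_def S_def[symmetric]
  proof (rule Greatest_equality)
    show "int f \<notin> int ` S"
      using f by auto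
    show "z \<le> int f" if "z \<notin> int ` S" for z
    proof (rule ccontr)
      assume "\<not> z \<le> int f"
      then have "nat z \<in> S" "z = int (nat z)"
        using f(2)[of "nat z"] by auto
      then show False
        using that by blast
    qed
  qed
  interpret generated_numerical_semigroup S "a 1" f "a ` {1..d}"
  proof
    show "a 1 \<in> a ` {1..d}" "a 1 \<in> S"
      using \<open>d \<ge> 1\<close> gen by auto
    show "\<exists>g\<in>a ` {1..d}. \<exists>s'\<in>S. g > 0 \<and> s = g + s'" if "s \<in> S" "s > 0" for s
      using generated_semigroup_split[of s d a] that unfolding S_def by blast
  qed (use f least large gen in auto)
  have "card (a ` {1..d}) = d"
    using strict_mono_on_imp_inj_on[OF mono] by (simp add: card_image)
  have "real (a 1) / real d \<le> real \<rho>" "real \<rho> - 1 < real (a 1) / real d"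
    using ceil by linarith+
  then have "real (a 1) \<le> real \<rho> * real d" "real (\<rho> - 1) * real d < real (a 1)"
    using \<open>d \<ge> 1\<close> \<open>\<rho> \<ge> 1\<close> by (simp_all add: field_simps of_nat_diff)
  then have bounds: "a 1 \<le> \<rho> * d" "(\<rho> - 1) * d < a 1"
    by (simp_all only: of_nat_mult[symmetric] of_nat_le_iff of_nat_less_iff)
  define n where "n = card (S \<inter> {..f})"
  have wilf_nat: "f + 1 \<le> d * n"
    unfolding n_def
    using wilf[OF \<open>\<rho> \<ge> 1\<close> _ \<open>card (a ` {1..d}) = d\<close> bounds large] primes by blast
  \<comment> \<open>All gaps lie in \<open>{..f}\<close>, so the denominator
    \<open>F + 1 - g\<close> equals \<open>n\<close>.\<close>
  have "{..f} = (S \<inter> {..f}) \<union> (- S)"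
    using f(2) by (auto simp: not_le[symmetric])
  then have "card {..f} = n + card (- S)"
    unfolding n_def using fin by (metis card_Un_disjoint disjoint_iff finite_Int finite_atMost
        Compl_iff IntE)
  then have "f + 1 = n + g"
    using g by (simp add: genus_def S_def Compl_eq_Diff_UNIV)
  then have "real_of_int F + 1 - real g = real n" "real_of_int F + 1 = real (f + 1)"
    using F_eq by simp_all
  moreover have "n > 0"
    using wilf_nat by (intro gr0I) simp
  moreover have "real (f + 1) \<le> real d * real n"
    using wilf_nat by (simp only: of_nat_mult[symmetric] of_nat_le_iff)
  ultimately show "real d \<ge> (real_of_int F + 1) / (real_of_int F + 1 - real g)"
    by (simp only: pos_divide_le_eq of_nat_0_less_iff)
qed

end
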